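(* Let $1\le k\le n$, let $\pi$ be uniformly random in $S_{b_2}$, and let $I_1^k,\dots,I_{n-k+1}^k$ be the potential $k$-cycles of $\pi$. For distinct $i,j\in\{1,\dots,n-k+1\}$, the indicator random variables of the events "$I_i^k$ is a cycle of $\pi$" and "$I_j^k$ is a cycle of $\pi$" are independent if and only if the two cycles $I_i^k$ and $I_j^k$ are at least $1$-distant, i.e. if and only if $|i-j|\ge k+1$.
   Context: $S_{b_2}$ is the set of permutations $\pi$ of $\{1,\dots,n\}$ with $\pi(i)\ge i-1$ for all $i\in\{2,\dots,n\}$. Every $k$-cycle of a permutation in $S_{b_2}$ is one of the $n-k+1$ cycles $I_i^k$, $i=1,\dots,n-k+1$, where $I_i^k$ is the cycle on the elements $i,i+1,\dots,i+k-1$ that sends $i\mapsto i+k-1$ and $j\mapsto j-1$ for $i<j\le i+k-1$ (for $k=1$, the fixed point $i$). Two different cycles $c$ (with elements $c_1,\dots,c_k$) and $d$ (with elements $d_1,\dots,d_m$) are called $p$-distant if $\min_{i,j}|c_i-d_j|>p$ and $p$ is the largest integer satisfying this inequality. "At least $1$-distant" means $p$-distant for some $p\ge1$, i.e. $\min_{i,j}|c_i-d_j|>1$. *)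

theory Defs
  imports "HOL-Probability.Probability" "HOL-Combinatorics.Combinatorics"
begin

definition S_b2 :: "nat \<Rightarrow> (nat \<Rightarrow> nat) set" where
  "S_b2 n = {\<pi>. \<pi> permutes {1..n} \<and> (\<forall>i\<in>{2..n}. \<pi> i \<ge> i - 1)}"

text \<open>
  A cycle is represented by the graph of its action on its own elements, that is, by the set of
  all pairs of an element and its image. Unlike the permutation that is the identity off the
  cycle, this keeps distinct fixed points apart: the fixed point \<open>i\<close> is \<open>{(i, i)}\<close>. Unlike a list,
  it does not depend on the choice of a first element. The elements of a cycle are its \<open>Field\<close>.
\<close>

type_synonym cyc = "(nat \<times> nat) set"

definition cycles_of :: "nat \<Rightarrow> (nat \<Rightarrow> nat) \<Rightarrow> cyc set" where
  "cycles_of n \<pi> = {{(y, \<pi> y) | y. y \<in> orbit \<pi> x} | x. x \<in> {1..n}}"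

definition I_cycle :: "nat \<Rightarrow> nat \<Rightarrow> cyc" where
  "I_cycle k i = insert (i, i + k - 1) {(j, j - 1) | j. i < j \<and> j \<le> i + k - 1}"

definition cycle_dist :: "cyc \<Rightarrow> cyc \<Rightarrow> int" where
  "cycle_dist c d = Min {\<bar>int x - int y\<bar> | x y. x \<in> Field c \<and> y \<in> Field d}"

text \<open>
  The parameter \<open>p\<close> is an integer and not a natural number: overlapping cycles have minimal
  distance \<open>0\<close> and are therefore \<open>-1\<close>-distant.
\<close>

definition distant :: "int \<Rightarrow> cyc \<Rightarrow> cyc \<Rightarrow> bool" where
  "distant p c d \<longleftrightarrow> c \<noteq> d \<and> cycle_dist c d > p \<and> (\<forall>q. cycle_dist c d > q \<longrightarrow> q \<le> p)"

definition at_least_distant :: "int \<Rightarrow> cyc \<Rightarrow> cyc \<Rightarrow> bool" where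
  "at_least_distant p c d \<longleftrightarrow> (\<exists>q\<ge>p. distant q c d)"

definition cycle_indicator :: "nat \<Rightarrow> cyc \<Rightarrow> (nat \<Rightarrow> nat) \<Rightarrow> real" where
  "cycle_indicator n c = indicator {\<pi>. c \<in> cycles_of n \<pi>}"

end

theory Submission
  imports Defs
begin

text \<open>
  Reading a permutation \<open>\<pi>\<close> in \<open>S_b2 n\<close> from left to right, either \<open>\<pi> (m + 1) = m\<close>, and then \<open>m\<close>
  and \<open>m + 1\<close> lie in one cycle, or \<open>\<pi> (m + 1) > m\<close>, and then no element crosses the gap between
  \<open>m\<close> and \<open>m + 1\<close>: there is a cut. So \<open>\<pi>\<close> is a way of cutting \<open>{1..n}\<close> into intervals,
  each of which is one cycle \<open>I_cycle\<close>, and any subset of the \<open>n - 1\<close> gaps can occur as the set of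
  cuts (\<open>bij_betw_cuts\<close>). Under the uniform distribution, the gaps are therefore independent
  fair coins.

  The event that \<open>I_cycle k i\<close> is a cycle of \<open>\<pi>\<close> prescribes the coins in the window
  \<open>{i - 1..i + k - 1}\<close>, as far as they exist: cuts at both ends and none strictly between
  (\<open>I_cycle_iff_cut_pattern\<close>). Two events that prescribe coins are independent iff they share no coin
  (\<open>indep_cut_patterns_iff\<close>). If they share a coin and disagree on it, they are disjoint events of
  positive probability; if they agree on all shared coins, the joint event fixes fewer coins than the
  two events together and is more likely than the product.

  For \<open>i < j\<close> the windows are disjoint iff \<open>i + k - 1 < j - 1\<close>, that is, \<open>j - i \<ge> k + 1\<close>. This is also
  the condition that the intervals \<open>{i..i + k - 1}\<close> and \<open>{j..j + k - 1}\<close> are at distance at least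
  \<open>2\<close>. Adjacent cycles, with \<open>j = i + k\<close>, share exactly the cut between them.
\<close>

section \<open>Permutations as sets of cuts\<close>

definition cuts :: "nat \<Rightarrow> (nat \<Rightarrow> nat) \<Rightarrow> nat set" where
  "cuts n \<pi> = {m \<in> {1..<n}. \<pi> (Suc m) \<noteq> m}"

lemma cuts_subset: "cuts n \<pi> \<subseteq> {1..<n}"
  by (auto simp: cuts_def)

lemma S_b2_permutes: "\<pi> \<in> S_b2 n \<Longrightarrow> \<pi> permutes {1..n}"
  by (simp add: S_b2_def)

lemma S_b2_lower_bound: "\<pi> \<in> S_b2 n \<Longrightarrow> x \<in> {1..n} \<Longrightarrow> x \<le> Suc (\<pi> x)"
  by (cases "x = 1") (auto simp: S_b2_def dest!: bspec[of _ _ x])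

text \<open>
  A cut \<open>m\<close> is a barrier. The lower bound lets elements to the right of it move left by one place at
  most, so only \<open>m + 1\<close> could cross, and at a cut it does not. Thus \<open>{m + 1..n}\<close> is mapped into
  itself, hence onto itself by finiteness, and nothing crosses from the left either.
\<close>

lemma S_b2_respects_cut:
  assumes \<pi>: "\<pi> \<in> S_b2 n" and m: "m \<in> cuts n \<pi>" and x: "x \<in> {1..n}"
  shows "\<pi> x \<le> m \<longleftrightarrow> x \<le> m"
proof -
  note perm = S_b2_permutes[OF \<pi>]
  have endo: "\<pi> ` {Suc m..n} \<subseteq> {Suc m..n}"
  proof (intro image_subsetI)
    fix y assume y: "y \<in> {Suc m..n}"
    have y': "y \<in> {1..n}" using y by auto
    have "\<pi> y \<le> n" using permutes_in_image[OF perm, of y] y' by simp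
    moreover have "m < \<pi> y"
    proof (cases "y = Suc m")
      case True
      then show ?thesis using m S_b2_lower_bound[OF \<pi> y'] by (simp add: cuts_def)
    next
      case False
      then show ?thesis using y S_b2_lower_bound[OF \<pi> y'] by simp
    qed
    ultimately show "\<pi> y \<in> {Suc m..n}" by simp
  qed
  have "\<pi> ` {Suc m..n} = {Suc m..n}"
    by (intro endo_inj_surj endo permutes_inj_on[OF perm]) auto
  then have "\<pi> x \<in> {Suc m..n} \<longleftrightarrow> x \<in> {Suc m..n}"
    using inj_image_mem_iff[OF permutes_inj[OF perm], of x "{Suc m..n}"] by simp
  then show ?thesis
    using x permutes_in_image[OF perm, of x] by auto
qed

text \<open>
  The cuts around a block confine \<open>\<pi> x\<close> to \<open>{x..e}\<close>, and each value \<open>m\<close> in \<open>{x..<e}\<close> is already taken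
  by \<open>m + 1\<close>. As an element that does not start a block moves left by one place, \<open>\<pi>\<close> is determined by
  its cuts.
\<close>

lemma S_b2_block_start:
  assumes \<pi>: "\<pi> \<in> S_b2 n" and x: "1 \<le> x" and e: "x \<le> e" "e \<le> n"
    and start: "x = 1 \<or> x - 1 \<in> cuts n \<pi>" and stop: "e = n \<or> e \<in> cuts n \<pi>"
    and uncut: "{x..<e} \<inter> cuts n \<pi> = {}"
  shows "\<pi> x = e"
proof (rule ccontr)
  assume "\<pi> x \<noteq> e"
  note perm = S_b2_permutes[OF \<pi>]
  have x': "x \<in> {1..n}" using x e by simp
  have rng: "\<pi> x \<in> {1..n}" using permutes_in_image[OF perm] x' by blast
  have "\<pi> x \<le> e"
    using stop rng S_b2_respects_cut[OF \<pi> _ x'] e by auto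
  moreover have "x \<le> \<pi> x"
    using start
  proof
    assume "x = 1" then show ?thesis using rng by simp
  next
    assume "x - 1 \<in> cuts n \<pi>"
    from S_b2_respects_cut[OF \<pi> this x'] show ?thesis using x by auto
  qed
  ultimately have mem: "\<pi> x \<in> {x..<e}" using \<open>\<pi> x \<noteq> e\<close> by simp
  then have "\<pi> x \<in> {1..<n}" "\<pi> x \<notin> cuts n \<pi>" using uncut x e by auto
  then have "\<pi> (Suc (\<pi> x)) = \<pi> x" by (simp add: cuts_def)
  then have "Suc (\<pi> x) = x" using permutes_inj[OF perm] by (simp add: inj_eq)
  then show False using mem by simp
qed

definition block_end :: "nat \<Rightarrow> nat set \<Rightarrow> nat \<Rightarrow> nat" where
  "block_end n C x = (LEAST e. x \<le> e \<and> (e = n \<or> e \<in> C))"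

lemma block_end:
  assumes "x \<le> n"
  shows "x \<le> block_end n C x" "block_end n C x \<le> n"
    "block_end n C x = n \<or> block_end n C x \<in> C"
    "\<And>e. x \<le> e \<Longrightarrow> e \<in> C \<Longrightarrow> block_end n C x \<le> e"
proof -
  let ?P = "\<lambda>e. x \<le> e \<and> (e = n \<or> e \<in> C)"
  have "?P n" using assms by simp
  from LeastI[of ?P, OF this] Least_le[of ?P, OF this]
  show "x \<le> block_end n C x" "block_end n C x \<le> n"
    "block_end n C x = n \<or> block_end n C x \<in> C"
    unfolding block_end_def by auto
  show "\<And>e. x \<le> e \<Longrightarrow> e \<in> C \<Longrightarrow> block_end n C x \<le> e"
    unfolding block_end_def by (rule Least_le) simp
qed

definition perm_of_cuts :: "nat \<Rightarrow> nat set \<Rightarrow> nat \<Rightarrow> nat" where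
  "perm_of_cuts n C x =
     (if x \<notin> {1..n} then x else if x = 1 \<or> x - 1 \<in> C then block_end n C x else x - 1)"

text \<open>
  Injectivity is enough, since the set is finite. The end of a block lies before the start of the next
  one, so two starts have different images; and the image of a start is \<open>n\<close> or a cut, whereas the
  image of any other element is neither.
\<close>

lemma perm_of_cuts_permutes:
  assumes C: "C \<subseteq> {1..<n}"
  shows "perm_of_cuts n C permutes {1..n}"
proof -
  let ?f = "perm_of_cuts n C"
  have endo: "?f ` {1..n} \<subseteq> {1..n}"
  proof (intro image_subsetI)
    fix x assume "x \<in> {1..n}"
    then show "?f x \<in> {1..n}"
      using block_end(1,2)[of x n C] by (auto simp: perm_of_cuts_def)
  qed
  have no_clash: "?f x \<noteq> ?f y" if "x < y" "x \<in> {1..n}" "y \<in> {1..n}" for x y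
  proof (cases "y - 1 \<in> C")
    case y: True
    have "?f x \<le> y - 1"
      using that y block_end(4)[of x n "y - 1" C] by (auto simp: perm_of_cuts_def)
    moreover have "y \<le> ?f y"
      using that y block_end(1)[of y n C] by (auto simp: perm_of_cuts_def)
    ultimately show ?thesis using that by simp
  next
    case y: False
    then have fy: "?f y = y - 1" using that by (auto simp: perm_of_cuts_def)
    show ?thesis
    proof (cases "x = 1 \<or> x - 1 \<in> C")
      case True
      then have "?f x = n \<or> ?f x \<in> C"
        using that block_end(3)[of x n C] by (auto simp: perm_of_cuts_def)
      then show ?thesis using fy y that by auto
    next
      case False
      then show ?thesis using fy that by (auto simp: perm_of_cuts_def)
    qed
  qed
  have inj: "inj_on ?f {1..n}"
    by (rule linorder_inj_onI) (use no_clash in auto)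
  have "bij_betw ?f {1..n} {1..n}"
    using inj endo_inj_surj[OF _ endo inj] by (simp add: bij_betw_def)
  then show ?thesis
    by (rule bij_imp_permutes) (simp add: perm_of_cuts_def)
qed

lemma perm_of_cuts_in_S_b2:
  assumes "C \<subseteq> {1..<n}"
  shows "perm_of_cuts n C \<in> S_b2 n"
proof -
  have "x - 1 \<le> perm_of_cuts n C x" if "x \<in> {2..n}" for x
    using that block_end(1)[of x n C] by (auto simp: perm_of_cuts_def)
  then show ?thesis
    using perm_of_cuts_permutes[OF assms] by (simp add: S_b2_def)
qed

lemma cuts_perm_of_cuts:
  assumes "C \<subseteq> {1..<n}"
  shows "cuts n (perm_of_cuts n C) = C"
proof -
  have "perm_of_cuts n C (Suc m) \<noteq> m \<longleftrightarrow> m \<in> C" if "m \<in> {1..<n}" for m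
    using that block_end(1)[of "Suc m" n C] by (auto simp: perm_of_cuts_def)
  then have "cuts n (perm_of_cuts n C) = {m \<in> {1..<n}. m \<in> C}"
    unfolding cuts_def by blast
  then show ?thesis using assms by blast
qed

lemma perm_of_cuts_cuts:
  assumes \<pi>: "\<pi> \<in> S_b2 n"
  shows "perm_of_cuts n (cuts n \<pi>) = \<pi>"
proof
  fix x
  let ?C = "cuts n \<pi>"
  consider "x \<notin> {1..n}" | "x \<in> {1..n}" "x = 1 \<or> x - 1 \<in> ?C" | "x \<in> {1..n}" "x \<noteq> 1" "x - 1 \<notin> ?C"
    by blast
  then show "perm_of_cuts n ?C x = \<pi> x"
  proof cases
    case 1
    then show ?thesis
      using S_b2_permutes[OF \<pi>] by (auto simp: perm_of_cuts_def permutes_def)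
  next
    case 2
    then have "\<pi> x = block_end n ?C x"
      using block_end[where x = x and n = n and C = ?C]
      by (intro S_b2_block_start[OF \<pi>]) (auto simp: not_le[symmetric])
    then show ?thesis using 2 by (simp add: perm_of_cuts_def)
  next
    case 3
    then show ?thesis by (auto simp: perm_of_cuts_def cuts_def)
  qed
qed

text \<open>Under this bijection the uniform distribution on \<open>S_b2 n\<close> becomes \<open>n - 1\<close> fair coin tosses.\<close>

lemma bij_betw_cuts: "bij_betw (cuts n) (S_b2 n) (Pow {1..<n})"
  by (rule bij_betw_byWitness[where f' = "perm_of_cuts n"])
     (auto simp: perm_of_cuts_cuts cuts_perm_of_cuts perm_of_cuts_in_S_b2 dest: subsetD[OF cuts_subset])

lemma finite_S_b2: "finite (S_b2 n)"
  using bij_betw_finite[OF bij_betw_cuts] by simp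

lemma card_S_b2: "card (S_b2 n) = 2 ^ (n - 1)"
  using bij_betw_same_card[OF bij_betw_cuts] by (simp add: card_Pow)

lemma S_b2_nonempty: "S_b2 n \<noteq> {}"
  using card_S_b2[of n] by auto

section \<open>Events that prescribe cuts\<close>

definition cut_pattern :: "nat \<Rightarrow> nat set \<Rightarrow> nat set \<Rightarrow> (nat \<Rightarrow> nat) set" where
  "cut_pattern n A B = {\<pi>. A \<subseteq> cuts n \<pi> \<and> B \<inter> cuts n \<pi> = {}}"

lemma card_subsets_with_pattern:
  assumes "finite U" "A \<subseteq> U" "B \<subseteq> U" "A \<inter> B = {}"
  shows "card {C \<in> Pow U. A \<subseteq> C \<and> B \<inter> C = {}} = 2 ^ (card U - card (A \<union> B))"
proof -
  \<comment> \<open>Only the elements outside \<open>A \<union> B\<close> can be chosen freely.\<close>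
  have "bij_betw (\<lambda>C. C - A) {C \<in> Pow U. A \<subseteq> C \<and> B \<inter> C = {}} (Pow (U - (A \<union> B)))"
    by (rule bij_betw_byWitness[where f' = "\<lambda>C. C \<union> A"]) (use assms in auto)
  from bij_betw_same_card[OF this] show ?thesis
    using assms by (simp add: card_Pow card_Diff_subset finite_subset)
qed

lemma prob_cut_pattern:
  assumes AB: "A \<subseteq> {1..<n}" "B \<subseteq> {1..<n}" "A \<inter> B = {}"
  shows "measure_pmf.prob (pmf_of_set (S_b2 n)) (cut_pattern n A B) = (1/2) ^ card (A \<union> B)"
proof -
  have "cuts n ` (S_b2 n \<inter> cut_pattern n A B)
      = {C \<in> cuts n ` S_b2 n. A \<subseteq> C \<and> B \<inter> C = {}}"
    unfolding cut_pattern_def by blast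
  then have "bij_betw (cuts n) (S_b2 n \<inter> cut_pattern n A B)
      {C \<in> Pow {1..<n}. A \<subseteq> C \<and> B \<inter> C = {}}"
    using bij_betw_cuts[of n] unfolding bij_betw_def by (auto intro: inj_on_subset)
  from bij_betw_same_card[OF this]
  have "card (S_b2 n \<inter> cut_pattern n A B) = 2 ^ (n - 1 - card (A \<union> B))"
    using card_subsets_with_pattern[OF _ AB] by simp
  moreover from AB have "card (A \<union> B) \<le> n - 1"
    using card_mono[of "{1..<n}" "A \<union> B"] by simp
  then have "(2::real) ^ (n - 1) = 2 ^ (n - 1 - card (A \<union> B)) * 2 ^ card (A \<union> B)"
    by (simp add: power_add[symmetric])
  ultimately show ?thesis
    by (simp add: measure_pmf_of_set finite_S_b2 S_b2_nonempty card_S_b2 power_one_over)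
qed

text \<open>
  When the two patterns agree, the joint event prescribes the union of the two sets of gaps, and its
  probability is the product iff the cardinalities add up. When they contradict each other, the joint
  event is empty although both events have positive probability.
\<close>

lemma indep_cut_patterns_iff:
  assumes A: "A \<subseteq> {1..<n}" "B \<subseteq> {1..<n}" "A \<inter> B = {}"
    and A': "A' \<subseteq> {1..<n}" "B' \<subseteq> {1..<n}" "A' \<inter> B' = {}"
  defines "P \<equiv> measure_pmf.prob (pmf_of_set (S_b2 n))"
  shows "P (cut_pattern n A B \<inter> cut_pattern n A' B') = P (cut_pattern n A B) * P (cut_pattern n A' B')
    \<longleftrightarrow> (A \<union> B) \<inter> (A' \<union> B') = {}"
proof -
  have eq: "cut_pattern n A B \<inter> cut_pattern n A' B' = cut_pattern n (A \<union> A') (B \<union> B')"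
    by (auto simp: cut_pattern_def)
  note pA = prob_cut_pattern[OF A] and pA' = prob_cut_pattern[OF A']
  have fin: "finite (A \<union> B)" "finite (A' \<union> B')"
    using A A' by (auto intro: finite_subset)
  show ?thesis
  proof (cases "(A \<union> A') \<inter> (B \<union> B') = {}")
    case True
    have "(A \<union> A') \<union> (B \<union> B') = (A \<union> B) \<union> (A' \<union> B')" by auto
    then have "P (cut_pattern n (A \<union> A') (B \<union> B')) = (1/2) ^ card ((A \<union> B) \<union> (A' \<union> B'))"
      using prob_cut_pattern[of "A \<union> A'" n "B \<union> B'"] A A' True by (simp add: P_def)
    then have "?thesis \<longleftrightarrow>
        (card ((A \<union> B) \<union> (A' \<union> B')) = card (A \<union> B) + card (A' \<union> B')
          \<longleftrightarrow> (A \<union> B) \<inter> (A' \<union> B') = {})"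
      unfolding eq unfolding P_def pA pA' power_add[symmetric] by (simp add: power_inject_exp')
    then show ?thesis
      using card_Un_Int[OF fin] finite_Int[OF disjI1[OF fin(1)], of "A' \<union> B'"] by auto
  next
    case False
    then have "cut_pattern n (A \<union> A') (B \<union> B') = {}"
      by (auto simp: cut_pattern_def)
    moreover have "(A \<union> B) \<inter> (A' \<union> B') \<noteq> {}" using False A(3) A'(3) by auto
    ultimately show ?thesis
      unfolding eq unfolding P_def pA pA' by simp
  qed
qed

text \<open>
  An indicator generates the same \<open>\<sigma>\<close>-algebra as its event, so independence of the random variables
  reduces to the product formula for the two events.
\<close>

lemma (in prob_space) indep_var_indicator_iff:
  fixes A B :: "'a set"
  assumes [measurable]: "A \<in> events" "B \<in> events"
  shows "indep_var borel (indicator A :: 'a \<Rightarrow> real) borel (indicator B :: 'a \<Rightarrow> real)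
    \<longleftrightarrow> prob (A \<inter> B) = prob A * prob B"
proof
  assume "indep_var borel (indicator A :: 'a \<Rightarrow> real) borel (indicator B :: 'a \<Rightarrow> real)"
  from indep_varD[OF this, of "{1}" "{1}"]
  have "prob ((\<lambda>x. (indicator A x :: real, indicator B x :: real)) -` ({1} \<times> {1}) \<inter> space M)
    = prob ((indicator A :: 'a \<Rightarrow> real) -` {1} \<inter> space M)
      * prob ((indicator B :: 'a \<Rightarrow> real) -` {1} \<inter> space M)" by simp
  moreover have "(\<lambda>x. (indicator A x :: real, indicator B x :: real)) -` ({1} \<times> {1}) \<inter> space M = A \<inter> B"
    "(indicator A :: 'a \<Rightarrow> real) -` {1} \<inter> space M = A"
    "(indicator B :: 'a \<Rightarrow> real) -` {1} \<inter> space M = B"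
    using assms[THEN sets.sets_into_space] by (auto simp: indicator_def split: if_splits)
  ultimately show "prob (A \<inter> B) = prob A * prob B" by simp
next
  assume "prob (A \<inter> B) = prob A * prob B"
  then have "indep_set {A} {B}" by (simp add: indep_sets2_eq assms)
  then have ind: "indep_set (sigma_sets (space M) {A}) (sigma_sets (space M) {B})"
    by (rule indep_set_sigma_sets) (auto simp: Int_stable_def)
  have sub: "sigma_sets (space M) {(indicator D :: 'a \<Rightarrow> real) -` X \<inter> space M | X. X \<in> sets borel}
      \<subseteq> sigma_sets (space M) {D}" if "D \<in> events" for D
  proof (rule sigma_sets_mono, safe)
    fix X :: "real set"
    have D: "D \<subseteq> space M" using that by (rule sets.sets_into_space)
    have "(indicator D :: 'a \<Rightarrow> real) -` X \<inter> space M \<in> {{}, D, space M - D, space M}"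
      using D by (cases "0 \<in> X"; cases "1 \<in> X") (auto simp: indicator_def of_bool_def split: if_splits)
    moreover have "space M - D \<in> sigma_sets (space M) {D}"
      by (intro sigma_sets.Compl sigma_sets.Basic) simp
    ultimately show "(indicator D :: 'a \<Rightarrow> real) -` X \<inter> space M \<in> sigma_sets (space M) {D}"
      by (auto intro: sigma_sets.Empty sigma_sets.Basic sigma_sets_top)
  qed
  show "indep_var borel (indicator A :: 'a \<Rightarrow> real) borel (indicator B :: 'a \<Rightarrow> real)"
    unfolding indep_var_eq indep_set_def
  proof (intro conjI)
    show "indep_sets (case_bool
        (sigma_sets (space M) {(indicator A :: 'a \<Rightarrow> real) -` X \<inter> space M | X. X \<in> sets borel})
        (sigma_sets (space M) {(indicator B :: 'a \<Rightarrow> real) -` X \<inter> space M | X. X \<in> sets borel})) UNIV"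
      by (rule indep_sets_mono_sets[OF ind[unfolded indep_set_def]])
         (simp add: sub assms split: bool.split)
  qed (rule borel_measurable_indicator, fact)+
qed

section \<open>The potential cycles\<close>

lemma Field_I_cycle:
  assumes "1 \<le> k"
  shows "Field (I_cycle k i) = {i..i + k - 1}"
  using assms by (auto simp: I_cycle_def Field_def Domain_iff Range_iff) 

lemma I_cycle_in_cycles_of_iff:
  assumes "1 \<le> k" "i \<in> {1..n}"
  shows "I_cycle k i \<in> cycles_of n \<pi>
    \<longleftrightarrow> \<pi> i = i + k - 1 \<and> (\<forall>j. i < j \<and> j \<le> i + k - 1 \<longrightarrow> \<pi> j = j - 1)"
proof
  assume "I_cycle k i \<in> cycles_of n \<pi>"
  then obtain x where "I_cycle k i = {(y, \<pi> y) | y. y \<in> orbit \<pi> x}"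
    by (auto simp: cycles_of_def)
  then have "b = \<pi> a" if "(a, b) \<in> I_cycle k i" for a b using that by blast
  then show "\<pi> i = i + k - 1 \<and> (\<forall>j. i < j \<and> j \<le> i + k - 1 \<longrightarrow> \<pi> j = j - 1)"
    by (auto simp: I_cycle_def)
next
  assume *: "\<pi> i = i + k - 1 \<and> (\<forall>j. i < j \<and> j \<le> i + k - 1 \<longrightarrow> \<pi> j = j - 1)"
  have "orbit \<pi> i = {i..i + k - 1}"
  proof
    have step: "\<pi> y \<in> {i..i + k - 1}" if "y \<in> {i..i + k - 1}" for y
      using * that assms by (cases "y = i") auto
    show "orbit \<pi> i \<subseteq> {i..i + k - 1}"
    proof
      fix y assume "y \<in> orbit \<pi> i"
      then show "y \<in> {i..i + k - 1}"
        by induction (use step assms in auto)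
    qed
  next
    show "{i..i + k - 1} \<subseteq> orbit \<pi> i"
    proof
      fix y assume "y \<in> {i..i + k - 1}"
      then have "y \<le> i + k - 1" "i \<le> y" by auto
      then show "y \<in> orbit \<pi> i"
      proof (induction y rule: inc_induct)
        case base
        then show ?case using * orbit.base[of \<pi> i] by simp
      next
        case (step y)
        then have "\<pi> (Suc y) = y" using * by simp
        then show ?case using step orbit.step[of "Suc y" \<pi> i] by simp
      qed
    qed
  qed
  moreover have "{i..i + k - 1} = insert i {j. i < j \<and> j \<le> i + k - 1}"
    using assms(1) by auto
  ultimately have "I_cycle k i = {(y, \<pi> y) | y. y \<in> orbit \<pi> i}"
    using * by (auto simp: I_cycle_def)
  then show "I_cycle k i \<in> cycles_of n \<pi>" using assms by (auto simp: cycles_of_def)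
qed

text \<open>
  The ends of the window are intersected with \<open>{1..<n}\<close> because a cycle that touches \<open>1\<close> or \<open>n\<close> needs
  no cut on that side.
\<close>

lemma I_cycle_iff_cut_pattern:
  assumes k: "1 \<le> k" "k \<le> n" and i: "i \<in> {1..n - k + 1}" and \<pi>: "\<pi> \<in> S_b2 n"
  shows "I_cycle k i \<in> cycles_of n \<pi>
    \<longleftrightarrow> \<pi> \<in> cut_pattern n ({i - 1, i + k - 1} \<inter> {1..<n}) {i..<i + k - 1}"
proof -
  have bounds: "1 \<le> i" "i \<in> {1..n}" "i + k - 1 \<le> n" using k i by auto
  show ?thesis
    unfolding I_cycle_in_cycles_of_iff[OF k(1) bounds(2)]
  proof
    assume *: "\<pi> i = i + k - 1 \<and> (\<forall>j. i < j \<and> j \<le> i + k - 1 \<longrightarrow> \<pi> j = j - 1)"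
    have inj: "\<pi> x = \<pi> y \<Longrightarrow> x = y" for x y
      using permutes_inj[OF S_b2_permutes[OF \<pi>]] by (simp add: inj_eq)
    have "\<pi> (Suc (i + k - 1)) \<noteq> i + k - 1"
      using * inj[of "Suc (i + k - 1)" i] k by auto
    then show "\<pi> \<in> cut_pattern n ({i - 1, i + k - 1} \<inter> {1..<n}) {i..<i + k - 1}"
      using * k by (auto simp: cut_pattern_def cuts_def)
  next
    assume *: "\<pi> \<in> cut_pattern n ({i - 1, i + k - 1} \<inter> {1..<n}) {i..<i + k - 1}"
    have "i = 1 \<or> i - 1 \<in> cuts n \<pi>"
    proof (cases "i = 1")
      case False
      then have "i - 1 \<in> {i - 1, i + k - 1} \<inter> {1..<n}" using bounds by auto
      then show ?thesis using * unfolding cut_pattern_def by blast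
    qed simp
    then have "\<pi> i = i + k - 1"
      using * bounds k by (intro S_b2_block_start[OF \<pi>]) (auto simp: cut_pattern_def)
    moreover have "\<pi> j = j - 1" if "i < j" "j \<le> i + k - 1" for j
    proof -
      have "j - 1 \<in> {i..<i + k - 1}" "j - 1 \<in> {1..<n}" using that bounds by auto
      then have "j - 1 \<notin> cuts n \<pi>" using * unfolding cut_pattern_def by blast
      then show ?thesis using that \<open>j - 1 \<in> {1..<n}\<close> by (simp add: cuts_def)
    qed
    ultimately show "\<pi> i = i + k - 1 \<and> (\<forall>j. i < j \<and> j \<le> i + k - 1 \<longrightarrow> \<pi> j = j - 1)" by simp
  qed
qed

text \<open>
  Over the integers, the largest \<open>q\<close> below the distance is the distance minus one, so two different
  cycles are at least \<open>p\<close>-distant as soon as their distance exceeds \<open>p\<close>.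
\<close>

lemma at_least_distant_iff:
  assumes c: "finite (Field c)" "Field c \<noteq> {}" and d: "finite (Field d)" "Field d \<noteq> {}"
  shows "at_least_distant p c d \<longleftrightarrow> c \<noteq> d \<and> (\<forall>x\<in>Field c. \<forall>y\<in>Field d. p < \<bar>int x - int y\<bar>)"
proof -
  let ?D = "{\<bar>int x - int y\<bar> | x y. x \<in> Field c \<and> y \<in> Field d}"
  have D: "?D = (\<lambda>(x, y). \<bar>int x - int y\<bar>) ` (Field c \<times> Field d)" by auto
  have "finite ?D" "?D \<noteq> {}" unfolding D using c d by auto
  then have "p < cycle_dist c d \<longleftrightarrow> (\<forall>x\<in>Field c. \<forall>y\<in>Field d. p < \<bar>int x - int y\<bar>)"
    unfolding cycle_dist_def by (subst Min_gr_iff) auto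
  moreover have "at_least_distant p c d \<longleftrightarrow> c \<noteq> d \<and> p < cycle_dist c d"
  proof
    assume "c \<noteq> d \<and> p < cycle_dist c d"
    then have "distant (cycle_dist c d - 1) c d" "p \<le> cycle_dist c d - 1"
      by (auto simp: distant_def)
    then show "at_least_distant p c d" unfolding at_least_distant_def by blast
  qed (auto simp: at_least_distant_def distant_def)
  ultimately show ?thesis by simp
qed

lemma at_least_1_distant_I_cycle_iff:
  assumes k: "1 \<le> k"
  shows "at_least_distant 1 (I_cycle k i) (I_cycle k j) \<longleftrightarrow> int k + 1 \<le> \<bar>int i - int j\<bar>"
proof -
  have "I_cycle k i = I_cycle k j \<longrightarrow> i = j"
    using Field_I_cycle[OF k, of i] Field_I_cycle[OF k, of j] k by (auto simp: Icc_eq_Icc)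
  moreover have "(\<forall>x\<in>{i..i + k - 1}. \<forall>y\<in>{j..j + k - 1}. 1 < \<bar>int x - int y\<bar>)
      \<longleftrightarrow> int k + 1 \<le> \<bar>int i - int j\<bar>" (is "?L \<longleftrightarrow> ?R")
  proof
    assume L: ?L
    show ?R
    proof (cases "i \<le> j")
      case True
      have "i + k - 1 < j"
      proof (rule ccontr)
        assume "\<not> i + k - 1 < j"
        then have "j \<in> {i..i + k - 1}" "j \<in> {j..j + k - 1}" using True k by auto
        from L[rule_format, OF this] show False by simp
      qed
      moreover have "i + k - 1 \<in> {i..i + k - 1}" "j \<in> {j..j + k - 1}" using k by auto
      moreover note L[rule_format, OF this]
      ultimately show ?thesis using k by linarith
    next
      case False
      have "j + k - 1 < i"
      proof (rule ccontr)
        assume "\<not> j + k - 1 < i"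
        then have "i \<in> {i..i + k - 1}" "i \<in> {j..j + k - 1}" using False k by auto
        from L[rule_format, OF this] show False by simp
      qed
      moreover have "i \<in> {i..i + k - 1}" "j + k - 1 \<in> {j..j + k - 1}" using k by auto
      moreover note L[rule_format, OF this]
      ultimately show ?thesis using k by linarith
    qed
  qed (use k in auto)
  ultimately show ?thesis
    using k by (subst at_least_distant_iff) (auto simp: Field_I_cycle)
qed

section \<open>Independence and distance\<close>

lemma windows_disjoint_iff:
  fixes i j k n :: nat
  assumes k: "1 \<le> k" and i: "i \<in> {1..n - k + 1}" and j: "j \<in> {1..n - k + 1}" and "i \<noteq> j"
  shows "({i - 1..i + k - 1} \<inter> {1..<n}) \<inter> ({j - 1..j + k - 1} \<inter> {1..<n}) = {}
    \<longleftrightarrow> int k + 1 \<le> \<bar>int i - int j\<bar>"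
proof -
  have *: "({l - 1..l + k - 1} \<inter> {1..<n}) \<inter> ({m - 1..m + k - 1} \<inter> {1..<n}) = {} \<longleftrightarrow> l + k + 1 \<le> m"
    if l: "l \<in> {1..n - k + 1}" and m: "m \<in> {1..n - k + 1}" and lm: "l < m" for l m
  proof
    assume "({l - 1..l + k - 1} \<inter> {1..<n}) \<inter> ({m - 1..m + k - 1} \<inter> {1..<n}) = {}"
    \<comment> \<open>If the windows overlap, the left end of the later window is a gap common to both.\<close>
    then have "m - 1 \<notin> ({l - 1..l + k - 1} \<inter> {1..<n}) \<inter> ({m - 1..m + k - 1} \<inter> {1..<n})" by blast
    moreover have "1 \<le> l" "1 \<le> m - 1" "m - 1 < n" using l m lm k by auto
    ultimately show "l + k + 1 \<le> m" using lm k by (simp del: One_nat_def) linarith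
  next
    assume "l + k + 1 \<le> m"
    then show "({l - 1..l + k - 1} \<inter> {1..<n}) \<inter> ({m - 1..m + k - 1} \<inter> {1..<n}) = {}" by auto
  qed
  show ?thesis
  proof (cases "i < j")
    case True
    show ?thesis unfolding *[OF i j True] using True by linarith
  next
    case False
    then have ji: "j < i" using \<open>i \<noteq> j\<close> by simp
    show ?thesis
      unfolding Int_commute[of "{i - 1..i + k - 1} \<inter> {1..<n}"] *[OF j i ji] using ji by linarith
  qed
qed

theorem proposition2p12:
  fixes n k i j :: nat
  assumes "1 \<le> k" and "k \<le> n"
    and "i \<in> {1..n - k + 1}" and "j \<in> {1..n - k + 1}" and "i \<noteq> j"
  shows "(prob_space.indep_var (measure_pmf (pmf_of_set (S_b2 n)))
            borel (cycle_indicator n (I_cycle k i))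
            borel (cycle_indicator n (I_cycle k j))
          \<longleftrightarrow> at_least_distant 1 (I_cycle k i) (I_cycle k j))
       \<and> (at_least_distant 1 (I_cycle k i) (I_cycle k j)
          \<longleftrightarrow> \<bar>int i - int j\<bar> \<ge> int k + 1)"
proof -
  let ?p = "pmf_of_set (S_b2 n)"
  let ?A = "\<lambda>l. {l - 1, l + k - 1} \<inter> {1..<n}" and ?B = "\<lambda>l. {l..<l + k - 1}"
  let ?E = "\<lambda>l. {\<pi>. I_cycle k l \<in> cycles_of n \<pi>}"
  let ?F = "\<lambda>l. cut_pattern n (?A l) (?B l)"
  have window: "?A l \<union> ?B l = {l - 1..l + k - 1} \<inter> {1..<n}" if "l \<in> {1..n - k + 1}" for l
    using that assms(1,2) by auto
  have sub: "?A l \<subseteq> {1..<n}" "?B l \<subseteq> {1..<n}" "?A l \<inter> ?B l = {}" if "l \<in> {1..n - k + 1}" for l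
    using that assms(1,2) by auto
  have set: "set_pmf ?p = S_b2 n" by (simp add: finite_S_b2 S_b2_nonempty)
  \<comment> \<open>Cycles and cut patterns agree on \<open>S_b2 n\<close> only, but this set carries all the probability.\<close>
  have same: "measure_pmf.prob ?p X = measure_pmf.prob ?p Y" if "X \<inter> S_b2 n = Y \<inter> S_b2 n" for X Y
    using that measure_Int_set_pmf[of ?p X] measure_Int_set_pmf[of ?p Y] by (simp add: set)
  have EF: "?E l \<inter> S_b2 n = ?F l \<inter> S_b2 n" if "l \<in> {1..n - k + 1}" for l
    using I_cycle_iff_cut_pattern[OF assms(1,2) that] by auto
  have "prob_space.indep_var ?p borel (cycle_indicator n (I_cycle k i)) borel (cycle_indicator n (I_cycle k j))
      \<longleftrightarrow> measure_pmf.prob ?p (?E i \<inter> ?E j) = measure_pmf.prob ?p (?E i) * measure_pmf.prob ?p (?E j)"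
    unfolding cycle_indicator_def by (rule measure_pmf.indep_var_indicator_iff) auto
  also have "\<dots> \<longleftrightarrow> measure_pmf.prob ?p (?F i \<inter> ?F j) = measure_pmf.prob ?p (?F i) * measure_pmf.prob ?p (?F j)"
  proof -
    have "(X \<inter> Y) \<inter> S = (X' \<inter> Y') \<inter> S" if "X \<inter> S = X' \<inter> S" "Y \<inter> S = Y' \<inter> S"
      for X Y X' Y' S :: "(nat \<Rightarrow> nat) set"
      using that by blast
    note joint = same[OF this[OF EF[OF assms(3)] EF[OF assms(4)]]]
    show ?thesis
      unfolding joint same[OF EF[OF assms(3)]] same[OF EF[OF assms(4)]] ..
  qed
  also have "\<dots> \<longleftrightarrow> (?A i \<union> ?B i) \<inter> (?A j \<union> ?B j) = {}"
    by (rule indep_cut_patterns_iff[OF sub[OF assms(3)] sub[OF assms(4)]])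
  also have "\<dots> \<longleftrightarrow> int k + 1 \<le> \<bar>int i - int j\<bar>"
    unfolding window[OF assms(3)] window[OF assms(4)]
    by (rule windows_disjoint_iff[OF assms(1,3-5)])
  finally show ?thesis
    unfolding at_least_1_distant_I_cycle_iff[OF assms(1)] by blast
qed

end
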